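(* If $A$ is a semisimple finite-dimensional algebra over a field $F$ of characteristic zero, then $A = Z(A) + [A,A]$.
   Context: Algebras are unital and associative. A semisimple algebra over a field $F$ is an associative Artinian $F$-algebra with zero Jacobson radical. $Z(A)$ is the center of $A$ and $[A,A]$ is the additive subgroup of $A$ generated by all additive commutators $ab-ba$ with $a,b\in A$. *)

theory Defs
  imports
    Complex_Main
    "HOL-Library.Set_Algebras"
    "HOL-Computational_Algebra.Group_Closure"
begin

text \<open>
  The sort \<open>{ring, monoid_mult}\<close> is that of unital associative rings. Unlike \<open>ring_1\<close>, it does
  not require \<open>0 \<noteq> 1\<close>, so the zero algebra is included.
\<close>

locale unital_algebra = vector_space scale
  for scale :: "'f::field \<Rightarrow> 'a::{ring,monoid_mult} \<Rightarrow> 'a" (infixr \<open>*s\<close> 75) +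
  assumes scale_mult_left: "(c *s a) * b = c *s (a * b)"
    and scale_mult_right: "a * (c *s b) = c *s (a * b)"

text \<open>
  Ideals are those of the underlying ring. In a unital algebra they are automatically closed under
  scalars, since \<open>c *s a = (c *s 1) * a\<close>.
\<close>

definition left_ideal :: "'a::ring set \<Rightarrow> bool"
  where "left_ideal I \<longleftrightarrow>
    0 \<in> I \<and> (\<forall>x\<in>I. \<forall>y\<in>I. x - y \<in> I) \<and> (\<forall>a. \<forall>x\<in>I. a * x \<in> I)"

definition maximal_left_ideal :: "'a::ring set \<Rightarrow> bool"
  where "maximal_left_ideal I \<longleftrightarrow>
    left_ideal I \<and> I \<noteq> UNIV \<and> (\<forall>J. left_ideal J \<longrightarrow> I \<subseteq> J \<longrightarrow> J = I \<or> J = UNIV)"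

text \<open>In the zero ring there are no maximal left ideals and the intersection is \<open>UNIV = {0}\<close>.\<close>

definition jacobson_radical :: "'a::{ring,monoid_mult} set"
  where "jacobson_radical = \<Inter> {I. maximal_left_ideal I}"

definition left_artinian :: "'a::ring itself \<Rightarrow> bool"
  where "left_artinian _ \<longleftrightarrow>
    (\<forall>I :: nat \<Rightarrow> 'a set. (\<forall>n. left_ideal (I n)) \<and> decseq I \<longrightarrow> (\<exists>N. \<forall>n\<ge>N. I n = I N))"

text \<open>
  Only the left-sided chain condition is required: for rings with zero Jacobson radical it is
  equivalent to the right-sided one, and the Jacobson radical itself is left-right symmetric.
\<close>

definition semisimple_algebra :: "('f::field \<Rightarrow> 'a::{ring,monoid_mult} \<Rightarrow> 'a) \<Rightarrow> bool"
  where "semisimple_algebra scale \<longleftrightarrow>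
    unital_algebra scale \<and> left_artinian TYPE('a) \<and> jacobson_radical = ({0} :: 'a set)"

definition finite_dimensional :: "('f::field \<Rightarrow> 'a::ab_group_add \<Rightarrow> 'a) \<Rightarrow> bool"
  where "finite_dimensional scale \<longleftrightarrow> (\<exists>Basis. finite_dimensional_vector_space scale Basis)"

definition algebra_center :: "'a::ring set"
  where "algebra_center = {z. \<forall>a. z * a = a * z}"

definition commutator_subgroup :: "'a::ring set"
  where "commutator_subgroup = group_closure {a * b - b * a | a b. True}"

end

theory Submission
  imports Defs
begin

text \<open>
  Let \<open>t a\<close> be the trace of left multiplication by \<open>a\<close> and consider the bilinear form
  \<open>(x, y) \<mapsto> t (x * y)\<close>. It is symmetric, because traces do not see the order of a product.

  Everything rests on one observation (\<open>nilpotentI_trace\<close>): if \<open>x\<close> is not nilpotent, then a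
  descending chain argument on the powers of \<open>x\<close> gives a non-zero idempotent \<open>x * g\<close> in which \<open>g\<close>
  commutes with everything that commutes with \<open>x\<close>. The trace of an idempotent is the dimension of its
  image, so in characteristic zero \<open>t (x * g) \<noteq> 0\<close>. Two consequences follow for an algebra whose
  Jacobson radical, and hence every nil left ideal, is zero.

  The form is nondegenerate (\<open>trace_form_nondegenerate\<close>): its radical is an ideal consisting of
  nilpotent elements.

  Only \<open>0\<close> is orthogonal to the centre and to all commutators (\<open>orthogonal_center_commutators\<close>).
  Indeed, if \<open>w\<close> is orthogonal to all commutators, then
  \<open>t ((w * a - a * w) * b) = t (w * (a * b - b * a)) = 0\<close> for all \<open>a\<close> and \<open>b\<close>, and nondegeneracy
  makes \<open>w\<close> central. Then the element \<open>g\<close> belonging to \<open>w\<close> is central as well, so orthogonality to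
  the centre forces \<open>w\<close> to be nilpotent. A central nilpotent element generates a nil ideal, so
  \<open>w = 0\<close>.

  Finally, \<open>Z(A) + [A, A]\<close> is a subspace, and a subspace of a finite-dimensional space with zero
  orthogonal complement under a nondegenerate form is the whole space
  (\<open>subspace_eq_UNIV_if_orthogonal_trivial\<close>).
\<close>


section \<open>Traces and nondegenerate forms on a finite-dimensional space\<close>

context finite_dimensional_vector_space
begin

lemma representation_linear_image:
  assumes B: "independent B" "span B = UNIV" and C: "independent C" "span C = UNIV"
    and g: "Vector_Spaces.linear scale scale g"
  shows "representation B (g v) b = (\<Sum>c\<in>C. representation C v c * representation B (g c) b)"
proof -
  interpret g: Vector_Spaces.linear scale scale g by fact
  have "g v = g (\<Sum>c\<in>C. scale (representation C v c) c)"
    using sum_representation_eq[OF C(1) _ finiteI_independent[OF C(1)] order_refl, of v] C(2)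
    by simp
  also have "\<dots> = (\<Sum>c\<in>C. scale (representation C v c) (g c))"
    by (simp add: g.sum g.scale)
  finally show ?thesis
    using B by (simp add: representation_sum representation_scale)
qed

text \<open>
  Both sides expand to the same double sum over matrix entries relative to the two bases. With
  \<open>B = C\<close> this is the cyclicity of the trace; with \<open>f\<close> the identity it is independence of the basis.
\<close>

lemma trace_swap:
  assumes B: "independent B" "span B = UNIV" and C: "independent C" "span C = UNIV"
    and f: "Vector_Spaces.linear scale scale f" and g: "Vector_Spaces.linear scale scale g"
  shows "(\<Sum>b\<in>B. representation B (g (f b)) b) = (\<Sum>c\<in>C. representation C (f (g c)) c)"
proof -
  have "(\<Sum>b\<in>B. representation B (g (f b)) b)
      = (\<Sum>b\<in>B. \<Sum>c\<in>C. representation C (f b) c * representation B (g c) b)"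
    by (rule sum.cong[OF refl representation_linear_image[OF B C g]])
  also have "\<dots> = (\<Sum>c\<in>C. \<Sum>b\<in>B. representation B (g c) b * representation C (f b) c)"
    by (subst sum.swap) (simp add: mult.commute)
  also have "\<dots> = (\<Sum>c\<in>C. representation C (f (g c)) c)"
    by (rule sum.cong[OF refl representation_linear_image[OF C B f, symmetric]])
  finally show ?thesis .
qed

text \<open>
  By nondegeneracy \<open>x \<mapsto> T x\<close> is an injective linear map from the space to its dual, hence onto. If
  \<open>V\<close> were proper, some vector \<open>w\<close> would therefore represent a functional that vanishes on \<open>V\<close> but not everywhere.
\<close>

lemma subspace_eq_UNIV_if_orthogonal_trivial:
  assumes V: "subspace V"
    and lin: "\<And>x. Vector_Spaces.linear scale (*) (\<lambda>y. T x y)"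
      "\<And>y. Vector_Spaces.linear scale (*) (\<lambda>x. T x y)"
    and nondegenerate: "\<And>x. (\<And>y. T x y = 0) \<Longrightarrow> x = 0"
    and orthogonal: "\<And>x. (\<And>v. v \<in> V \<Longrightarrow> T x v = 0) \<Longrightarrow> x = 0"
  shows "V = UNIV"
proof (rule ccontr)
  assume "V \<noteq> UNIV"
  have left: "T (x + y) z = T x z + T y z" "T (scale r x) z = r * T x z" for r x y z
    using lin(2)[of z] by (simp_all add: Vector_Spaces.linear_iff)
  obtain C where C: "C \<subseteq> V" "independent C" "V \<subseteq> span C"
    using basis_exists[of V] by metis
  obtain B where B: "C \<subseteq> B" "independent B" "span B = UNIV"
    using maximal_independent_subset_extend[OF subset_UNIV C(2)] by (metis top.extremum_uniqueI)
  have "span C = V"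
    using C V by (simp add: span_minimal subset_antisym)
  then have "B \<noteq> C" using \<open>V \<noteq> UNIV\<close> B(3) by blast
  then obtain b where b: "b \<in> B" "b \<notin> C"
    using B(1) by blast
  note fin = finiteI_independent[OF B(2)]
  have zero_if_zero_on_span: "T x v = 0" if "\<And>c. c \<in> S \<Longrightarrow> T x c = 0" "v \<in> span S" for x v S
  proof -
    interpret x: Vector_Spaces.linear scale "(*)" "\<lambda>y. T x y" by (rule lin)
    from that(2) show ?thesis
      by (rule span_induct_alt) (use that(1) x.zero x.add x.scale in auto)
  qed
  \<comment> \<open>Identify the dual with the space itself, taking the values on \<open>B\<close> as coordinates.\<close>
  define \<phi> where "\<phi> x = (\<Sum>c\<in>B. scale (T x c) c)" for x
  have coeff: "representation B (\<phi> x) c = T x c" if "c \<in> B" for x c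
  proof -
    have "representation B (\<phi> x) c = (\<Sum>d\<in>B. T x d * (if c = d then 1 else 0))"
      unfolding \<phi>_def using B(2,3)
      by (simp add: representation_sum representation_scale representation_basis)
    also have "\<dots> = T x c"
      using that fin by (simp add: if_distrib cong: if_cong)
    finally show ?thesis .
  qed
  have \<phi>: "Vector_Spaces.linear scale scale \<phi>"
    unfolding Vector_Spaces.linear_iff \<phi>_def
    by (simp add: left scale_left_distrib sum.distrib scale_sum_right vector_space_axioms)
  interpret \<phi>: Vector_Spaces.linear scale scale \<phi> by (rule \<phi>)
  have "inj \<phi>"
    unfolding \<phi>.inj_iff_eq_0
  proof (intro allI impI)
    fix x assume "\<phi> x = 0"
    then have "T x c = 0" if "c \<in> B" for c
      using coeff[OF that, of x] by (simp add: representation_zero)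
    then have "T x y = 0" for y
      using zero_if_zero_on_span[of B x y] B(3) by simp
    then show "x = 0" by (rule nondegenerate)
  qed
  then have "surj \<phi>"
    by (rule linear_inj_imp_surj[OF \<phi>])
  then obtain w where w: "\<phi> w = b"
    by (metis surjD)
  have Tw: "T w c = (if c = b then 1 else 0)" if "c \<in> B" for c
    using coeff[OF that, of w] w representation_basis[OF B(2) b(1)] by simp
  have "T w v = 0" if "v \<in> V" for v
    using zero_if_zero_on_span[of C w v] Tw B(1) b(2) that \<open>span C = V\<close> by (metis subsetD)
  then have "w = 0" by (rule orthogonal)
  then have "b = 0" using w \<phi>.zero by simp
  then show False using b(1) B(2) dependent_zero by blast
qed

end


section \<open>Nil left ideals and the Jacobson radical\<close>

lemma power_mult_distrib_central:
  fixes a w :: "'a::monoid_mult"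
  assumes "\<And>b. w * b = b * w"
  shows "(a * w) ^ n = a ^ n * w ^ n"
proof (induction n)
  case (Suc n)
  have "(a * w) ^ Suc n = a * (w * a ^ n) * w ^ n"
    by (simp add: Suc mult.assoc)
  also have "\<dots> = a ^ Suc n * w ^ Suc n"
    by (simp only: assms[of "a ^ n"] power_Suc mult.assoc)
  finally show ?case .
qed simp

text \<open>
  If a maximal left ideal \<open>M\<close> missed some \<open>x \<in> I\<close>, then \<open>M + A x = A\<close> would give \<open>1 - a * x \<in> M\<close>.
  But \<open>a * x\<close> is nilpotent, so \<open>1 - a * x\<close> has a left inverse, and \<open>M\<close> would contain \<open>1\<close>.
\<close>

lemma nil_left_ideal_subset_jacobson_radical:
  fixes I :: "'a::{ring,monoid_mult} set"
  assumes I: "left_ideal I" and nil: "\<And>x. x \<in> I \<Longrightarrow> \<exists>n. x ^ n = 0"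
  shows "I \<subseteq> jacobson_radical"
  unfolding jacobson_radical_def
proof (intro subsetI InterI)
  fix x M assume x: "x \<in> I" and "M \<in> {I :: 'a set. maximal_left_ideal I}"
  then have M: "left_ideal M" "M \<noteq> UNIV"
    and max: "\<And>J. left_ideal J \<Longrightarrow> M \<subseteq> J \<Longrightarrow> J = M \<or> J = UNIV"
    by (auto simp: maximal_left_ideal_def)
  have M0: "0 \<in> M" and Md: "\<And>u v. u \<in> M \<Longrightarrow> v \<in> M \<Longrightarrow> u - v \<in> M"
    and Mm: "\<And>a u. u \<in> M \<Longrightarrow> a * u \<in> M"
    using M(1) by (auto simp: left_ideal_def)
  have Ma: "u + v \<in> M" if "u \<in> M" "v \<in> M" for u v
    using Md[OF that(1) Md[OF M0 that(2)]] by simp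
  show "x \<in> M"
  proof (rule ccontr)
    assume "x \<notin> M"
    define J where "J = {m + a * x | m a. m \<in> M}"
    have "left_ideal J"
      unfolding left_ideal_def
    proof (intro conjI ballI allI)
      show "0 \<in> J"
        unfolding J_def using M0 by (auto intro!: exI[of _ 0])
    next
      fix u v assume "u \<in> J" "v \<in> J"
      then obtain m a m' a' where "u = m + a * x" "v = m' + a' * x" "m \<in> M" "m' \<in> M"
        by (auto simp: J_def)
      then have "u - v = (m - m') + (a - a') * x" "m - m' \<in> M"
        by (auto simp: algebra_simps Md)
      then show "u - v \<in> J" unfolding J_def by blast
    next
      fix b u assume "u \<in> J"
      then obtain m a where "u = m + a * x" "m \<in> M"
        by (auto simp: J_def)
      then have "b * u = b * m + (b * a) * x" "b * m \<in> M"
        by (auto simp: algebra_simps Mm)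
      then show "b * u \<in> J" unfolding J_def by blast
    qed
    moreover have "M \<subseteq> J"
    proof
      fix m assume "m \<in> M"
      moreover have "m = m + 0 * x" by simp
      ultimately show "m \<in> J" unfolding J_def by blast
    qed
    moreover have "x \<in> J"
    proof -
      have "x = 0 + 1 * x" by simp
      then show ?thesis unfolding J_def using M0 by blast
    qed
    ultimately have "1 \<in> J"
      using max \<open>x \<notin> M\<close> by blast
    then obtain m a where ma: "1 = m + a * x" "m \<in> M"
      by (auto simp: J_def)
    then have base: "1 - a * x \<in> M"
      by (metis add_diff_cancel_right')
    have "a * x \<in> I"
      using I x by (simp add: left_ideal_def)
    then obtain n where n: "(a * x) ^ n = 0"
      using nil by blast
    have "1 - (a * x) ^ k \<in> M" for k
    proof (induction k)
      case (Suc k)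
      have "1 - (a * x) ^ Suc k = (1 - (a * x) ^ k) + (a * x) ^ k * (1 - a * x)"
        by (simp add: right_diff_distrib power_Suc2 del: power_Suc)
      then show ?case using Ma[OF Suc Mm[OF base]] by metis
    qed (simp add: M0)
    from this[of n] have "1 \<in> M" by (simp add: n)
    then have "UNIV \<subseteq> M" using Mm[of 1] by (metis mult_1_right subsetI)
    with M(2) show False by blast
  qed
qed


section \<open>The trace form of an algebra\<close>

locale finite_dimensional_algebra =
  unital_algebra scale + finite_dimensional_vector_space scale Basis
  for scale :: "'f::field_char_0 \<Rightarrow> 'a::{ring,monoid_mult} \<Rightarrow> 'a" (infixr \<open>*s\<close> 75) and Basis
begin

lemma linear_mult_left: "Vector_Spaces.linear scale scale (\<lambda>x. a * x)"
  by (simp add: Vector_Spaces.linear_iff vector_space_axioms distrib_left scale_mult_right)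

definition trace :: "'a \<Rightarrow> 'f"
  where "trace a = (\<Sum>b\<in>Basis. representation Basis (a * b) b)"

lemma trace_commute: "trace (a * b) = trace (b * a)"
  using trace_swap[OF independent_Basis span_Basis independent_Basis span_Basis
      linear_mult_left[of b] linear_mult_left[of a]]
  by (simp add: trace_def mult.assoc)

lemma trace_eq_sum_basis:
  assumes "independent B" "span B = UNIV"
  shows "trace a = (\<Sum>b\<in>B. representation B (a * b) b)"
  using trace_swap[OF independent_Basis span_Basis assms
      linear_mult_left[of 1] linear_mult_left[of a]]
  by (simp add: trace_def)

lemma linear_trace: "Vector_Spaces.linear scale (*) trace"
proof -
  have "vector_space ((*) :: 'f \<Rightarrow> 'f \<Rightarrow> 'f)"
    by unfold_locales (simp_all add: algebra_simps)
  moreover have "trace (a + b) = trace a + trace b" for a b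
    by (simp add: trace_def distrib_right representation_add independent_Basis span_Basis
        sum.distrib)
  moreover have "trace (c *s a) = c * trace a" for c a
    by (simp add: trace_def scale_mult_left representation_scale independent_Basis span_Basis
        sum_distrib_left)
  ultimately show ?thesis
    by (simp add: Vector_Spaces.linear_iff vector_space_axioms)
qed

lemma linear_trace_form:
  "Vector_Spaces.linear scale (*) (\<lambda>y. trace (x * y))" "Vector_Spaces.linear scale (*) (\<lambda>x. trace (x * y))"
  using linear_trace
  by (simp_all add: Vector_Spaces.linear_iff distrib_left distrib_right
      scale_mult_left scale_mult_right)

text \<open>
  In a basis extending one of the image \<open>e A\<close>, the matrix of left multiplication by \<open>e\<close> has diagonal
  entries \<open>1\<close> on \<open>e A\<close> and \<open>0\<close> elsewhere. The trace is thus the dimension of \<open>e A\<close>, which is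
  non-zero in characteristic zero.
\<close>

lemma trace_idempotent_nonzero:
  assumes e: "e * e = e" "e \<noteq> 0"
  shows "trace e \<noteq> 0"
proof -
  obtain C where C: "C \<subseteq> range (\<lambda>x. e * x)" "independent C" "range (\<lambda>x. e * x) \<subseteq> span C"
    using basis_exists[of "range (\<lambda>x. e * x)"] by metis
  obtain B where B: "C \<subseteq> B" "independent B" "span B = UNIV"
    using maximal_independent_subset_extend[OF subset_UNIV C(2)] by (metis top.extremum_uniqueI)
  note fin = finiteI_independent[OF B(2)]
  have diagonal: "representation B (e * b) b = (if b \<in> C then 1 else 0)" if "b \<in> B" for b
  proof (cases "b \<in> C")
    case True
    then have "e * b = b"
      using C(1) e(1) by (force simp: mult.assoc[symmetric])
    then show ?thesis
      using True by (simp add: representation_basis[OF B(2) that])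
  next
    case False
    have "e * b \<in> span C" using C(3) by blast
    then have "representation B (e * b) = representation C (e * b)"
      by (rule representation_extend[OF B(2) _ B(1)])
    then show ?thesis
      using False representation_ne_zero by metis
  qed
  have "trace e = (\<Sum>b\<in>B. if b \<in> C then 1 else 0)"
    by (simp add: trace_eq_sum_basis[OF B(2,3)] diagonal)
  also have "\<dots> = of_nat (card C)"
    using B(1) fin by (simp add: sum.If_cases Int_absorb1)
  finally have "trace e = of_nat (card C)" .
  moreover have "C \<noteq> {}"
  proof
    assume "C = {}"
    moreover have "e * 1 \<in> span C" using C(3) by blast
    ultimately show False using e(2) by simp
  qed
  ultimately show ?thesis
    using B(1) fin by (simp add: finite_subset)
qed

text \<open>
  Among the spans \<open>U k\<close> of all \<open>x ^ j\<close> with \<open>j \<ge> k \<ge> 1\<close>, choose one of least dimension. Then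
  \<open>x ^ k \<in> U k = U (2 * k)\<close>, so \<open>x ^ k = x ^ k * x ^ k * h\<close> for a linear combination \<open>h\<close> of powers
  of \<open>x\<close>, and \<open>x ^ k * h\<close> is idempotent. It is non-zero because \<open>x ^ k\<close> is. The factor
  \<open>g = x ^ (k - 1) * h\<close> commutes with all that commutes with \<open>x\<close>, as every power of \<open>x\<close> does; in
  particular it is central if \<open>x\<close> is.
\<close>

lemma not_nilpotent_imp_idempotent_multiple:
  fixes x :: 'a
  assumes "\<And>n. x ^ n \<noteq> 0"
  obtains g where "\<And>b. b * x = x * b \<Longrightarrow> b * g = g * b"
    and "(x * g) * (x * g) = x * g" and "x * g \<noteq> 0"
proof -
  define D where "D = {g. \<forall>b. b * x = x * b \<longrightarrow> b * g = g * b}"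
  define U where "U k = span {x ^ j | j. j \<ge> k}" for k
  have power_commutes_x: "b * x ^ j = x ^ j * b" if "b * x = x * b" for b j
    using power_commuting_commutes[of x b j] that by simp
  have power_D: "x ^ j \<in> D" for j
    unfolding D_def using power_commutes_x by blast
  have D_mult: "g * h \<in> D" if "g \<in> D" "h \<in> D" for g h
  proof -
    have "b * (g * h) = (g * h) * b" if "b * x = x * b" for b
    proof -
      have "b * g = g * b" "b * h = h * b"
        using that \<open>g \<in> D\<close> \<open>h \<in> D\<close> by (auto simp: D_def)
      then show ?thesis by (metis mult.assoc)
    qed
    then show ?thesis by (simp add: D_def)
  qed
  have D_commute: "g * h = h * g" if "g \<in> D" "h \<in> D" for g h
  proof -
    have "x * g = g * x" using that(1) by (simp add: D_def)
    then show ?thesis using that(2) by (simp add: D_def)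
  qed
  obtain k where k: "0 < k" "\<And>l. 0 < l \<Longrightarrow> dim (U k) \<le> dim (U l)"
    using ex_has_least_nat[of "\<lambda>k. 0 < k" 1 "\<lambda>k. dim (U k)"] by auto
  have "U (2 * k) = U k"
  proof (rule subspace_dim_equal)
    show "U (2 * k) \<subseteq> U k"
      unfolding U_def by (rule span_mono) auto
    show "dim (U k) \<le> dim (U (2 * k))"
      using k by simp
  qed (simp_all add: U_def)
  moreover have "x ^ k \<in> U k"
    unfolding U_def by (rule span_base) auto
  moreover have "U (2 * k) \<subseteq> {x ^ k * x ^ k * g | g. g \<in> D}"
    unfolding U_def
  proof (rule span_minimal)
    show "{x ^ j |j. 2 * k \<le> j} \<subseteq> {x ^ k * x ^ k * g | g. g \<in> D}"
    proof safe
      fix j assume "2 * k \<le> j"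
      then have "x ^ j = x ^ k * x ^ k * x ^ (j - 2 * k)"
        by (simp add: power_add[symmetric] mult_2)
      then show "\<exists>g. x ^ j = x ^ k * x ^ k * g \<and> g \<in> D"
        using power_D by blast
    qed
    have "0 \<in> D" "\<And>g h. g \<in> D \<Longrightarrow> h \<in> D \<Longrightarrow> g + h \<in> D" "\<And>c g. g \<in> D \<Longrightarrow> c *s g \<in> D"
      by (auto simp: D_def distrib_left distrib_right scale_mult_left scale_mult_right)
    then have "subspace D"
      by (simp add: subspace_def)
    interpret xk: Vector_Spaces.linear scale scale "\<lambda>g. x ^ k * x ^ k * g"
      by (rule linear_mult_left)
    from \<open>subspace D\<close> have "subspace ((\<lambda>g. x ^ k * x ^ k * g) ` D)"
      by (rule xk.subspace_image)
    then show "subspace {x ^ k * x ^ k * g | g. g \<in> D}"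
      by (simp add: image_def setcompr_eq_image)
  qed
  ultimately obtain h where h: "h \<in> D" "x ^ k = x ^ k * x ^ k * h"
    by blast
  define g where "g = x ^ (k - 1) * h"
  have xg: "x * g = x ^ k * h"
    using k(1) by (cases k) (simp_all add: g_def mult.assoc)
  show thesis
  proof (rule that)
    show "b * g = g * b" if "b * x = x * b" for b
      using that D_mult[OF power_D h(1)] unfolding g_def D_def by blast
    have "(x ^ k * h) * (x ^ k * h) = (x ^ k * x ^ k * h) * h"
      using D_commute[OF h(1) power_D[of k]] by (metis mult.assoc)
    then show "(x * g) * (x * g) = x * g"
      using h(2) xg by simp
    show "x * g \<noteq> 0"
    proof
      assume "x * g = 0"
      then have "x ^ k * (x ^ k * h) = 0" using xg by simp
      with h(2) assms[of k] show False by (simp add: mult.assoc)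
    qed
  qed
qed

text \<open>
  Restricting \<open>g\<close> to the double centralizer of \<open>x\<close> makes the criterion applicable to a central \<open>x\<close> of
  which only the traces against central elements are known to vanish.
\<close>

lemma nilpotentI_trace:
  assumes "\<And>g. (\<And>b. b * x = x * b \<Longrightarrow> b * g = g * b) \<Longrightarrow> trace (x * g) = 0"
  shows "\<exists>n. x ^ n = 0"
proof (rule ccontr)
  assume "\<nexists>n. x ^ n = 0"
  then obtain g where "\<And>b. b * x = x * b \<Longrightarrow> b * g = g * b"
    and "(x * g) * (x * g) = x * g" "x * g \<noteq> 0"
    using not_nilpotent_imp_idempotent_multiple[of x] by metis
  with assms trace_idempotent_nonzero show False by blast
qed

end


section \<open>Semisimple algebras\<close>

lemma algebra_center_iff: "z \<in> algebra_center \<longleftrightarrow> (\<forall>a. z * a = a * z)"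
  by (simp add: algebra_center_def)

lemma commutator_in_commutator_subgroup: "a * b - b * a \<in> commutator_subgroup"
  unfolding commutator_subgroup_def by (rule group_closure.base) blast

context finite_dimensional_algebra
begin

lemma subspace_algebra_center: "subspace algebra_center"
  by (simp add: subspace_def algebra_center_iff distrib_left distrib_right
      scale_mult_left scale_mult_right)

text \<open>
  A scalar can be absorbed into one factor of a commutator, so the additive subgroup is already
  closed under scalars.
\<close>

lemma subspace_commutator_subgroup: "subspace commutator_subgroup"
  unfolding subspace_def
proof (intro conjI ballI allI)
  show "0 \<in> commutator_subgroup"
    by (simp add: commutator_subgroup_def)
  show "u + v \<in> commutator_subgroup"
    if "u \<in> commutator_subgroup" "v \<in> commutator_subgroup" for u v
    using that unfolding commutator_subgroup_def by (rule group_closure_add)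
  show "c *s u \<in> commutator_subgroup" if "u \<in> commutator_subgroup" for c u
    using that unfolding commutator_subgroup_def
  proof induction
    case (base s)
    then consider "s = 0" | a b where "s = a * b - b * a" by blast
    then show ?case
    proof cases
      case 2
      then have "c *s s = (c *s a) * b - b * (c *s a)"
        by (simp add: scale_right_diff_distrib scale_mult_left scale_mult_right)
      then show ?thesis
        using commutator_in_commutator_subgroup[of "c *s a" b]
        by (simp only: commutator_subgroup_def)
    qed simp
  next
    case (diff s t)
    then show ?case
      by (simp add: scale_right_diff_distrib group_closure.diff)
  qed
qed

context
  assumes radical_zero: "jacobson_radical = {0 :: 'a}"
begin

lemma trace_form_nondegenerate:
  assumes "\<And>y. trace (x * y) = 0"
  shows "x = 0"
proof -
  define I where "I = {x. \<forall>y. trace (x * y) = 0}"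
  interpret trace: Vector_Spaces.linear scale "(*)" trace by (rule linear_trace)
  have "left_ideal I"
    unfolding left_ideal_def I_def
  proof (safe, goal_cases)
    case (3 a x y)
    have "trace (a * x * y) = trace (x * (y * a))"
      by (metis trace_commute mult.assoc)
    with 3 show ?case by simp
  qed (simp_all add: left_diff_distrib trace.zero trace.diff)
  then have "I \<subseteq> jacobson_radical"
    by (rule nil_left_ideal_subset_jacobson_radical) (auto simp: I_def intro: nilpotentI_trace)
  moreover have "x \<in> I" using assms by (simp add: I_def)
  ultimately show ?thesis using radical_zero by blast
qed

lemma central_nilpotent_eq_0:
  fixes w :: 'a
  assumes central: "\<And>b. w * b = b * w" and nilpotent: "w ^ n = 0"
  shows "w = 0"
proof -
  have "left_ideal (range (\<lambda>a. a * w))"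
    unfolding left_ideal_def
    by (auto simp: left_diff_distrib[symmetric] mult.assoc[symmetric] intro: range_eqI[of _ _ 0])
  moreover have "\<exists>n. y ^ n = 0" if y: "y \<in> range (\<lambda>a. a * w)" for y
  proof -
    from y obtain a where "y = a * w" by blast
    then have "y ^ n = 0"
      using power_mult_distrib_central[OF central] nilpotent by simp
    then show ?thesis by blast
  qed
  ultimately have "range (\<lambda>a. a * w) \<subseteq> jacobson_radical"
    by (rule nil_left_ideal_subset_jacobson_radical)
  moreover have "w \<in> range (\<lambda>a. a * w)"
    by (rule range_eqI[of _ _ 1]) simp
  ultimately show ?thesis
    using radical_zero by blast
qed

lemma orthogonal_center_commutators:
  assumes center: "\<And>z. z \<in> algebra_center \<Longrightarrow> trace (w * z) = 0"
    and commutators: "\<And>a b. trace (w * (a * b - b * a)) = 0"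
  shows "w = 0"
proof -
  interpret trace: Vector_Spaces.linear scale "(*)" trace by (rule linear_trace)
  have central: "w * a = a * w" for a
  proof -
    have "trace ((w * a - a * w) * b) = 0" for b
    proof -
      have "trace ((a * w) * b) = trace (w * (b * a))"
        by (metis trace_commute mult.assoc)
      then show ?thesis
        using commutators[of a b]
        by (simp add: left_diff_distrib right_diff_distrib trace.diff mult.assoc)
    qed
    then have "w * a - a * w = 0" by (rule trace_form_nondegenerate)
    then show ?thesis by simp
  qed
  then have "\<exists>n. w ^ n = 0"
    by (intro nilpotentI_trace center) (simp add: algebra_center_iff)
  then show ?thesis
    using central_nilpotent_eq_0[OF central] by blast
qed

lemma UNIV_eq_center_plus_commutators: "UNIV = algebra_center + (commutator_subgroup :: 'a set)"
proof -
  note Z = subspace_algebra_center and K = subspace_commutator_subgroup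
  have sum: "algebra_center + commutator_subgroup
      = {z + k | z k. z \<in> algebra_center \<and> k \<in> (commutator_subgroup :: 'a set)}"
    by (auto simp: set_plus_def)
  have "algebra_center + commutator_subgroup = (UNIV :: 'a set)"
  proof (rule subspace_eq_UNIV_if_orthogonal_trivial[where T = "\<lambda>x y. trace (x * y)"])
    show "subspace (algebra_center + commutator_subgroup)"
      unfolding sum by (rule subspace_sums[OF Z K])
    fix w assume w: "\<And>v. v \<in> algebra_center + commutator_subgroup \<Longrightarrow> trace (w * v) = 0"
    show "w = 0"
    proof (rule orthogonal_center_commutators)
      show "trace (w * z) = 0" if "z \<in> algebra_center" for z
        using w[OF set_plus_intro[OF that subspace_0[OF K]]] by simp
      show "trace (w * (a * b - b * a)) = 0" for a b
        using w[OF set_plus_intro[OF subspace_0[OF Z] commutator_in_commutator_subgroup]] by simp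
    qed
  qed (use linear_trace_form trace_form_nondegenerate in auto)
  then show ?thesis ..
qed

end

end

theorem corollary2p3:
  fixes scale :: "'f::field_char_0 \<Rightarrow> 'a::{ring,monoid_mult} \<Rightarrow> 'a"
  assumes "semisimple_algebra scale"
    and "finite_dimensional scale"
  shows "(UNIV :: 'a set) = algebra_center + commutator_subgroup"
proof -
  obtain Basis where "finite_dimensional_vector_space scale Basis"
    using assms(2) by (auto simp: finite_dimensional_def)
  then interpret finite_dimensional_algebra scale Basis
    using assms(1) by (simp add: finite_dimensional_algebra_def semisimple_algebra_def)
  show ?thesis
    using assms(1) by (intro UNIV_eq_center_plus_commutators) (simp add: semisimple_algebra_def)
qed

end
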